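(* Let $\gamma_h=y^2[h+1]_q+[h]_q+ytq^h([h]_q+[h+1]_q)$ for $h\ge0$ and $\lambda_h=y[h]_q^2(y+tq^{h-1})(1+ytq^h)$ for $h\ge1$. Then, as formal power series in $z$, \[ \sum_{n\ge0}B_n(y,t,q)z^n=\cfrac{1}{1-\gamma_0z-\cfrac{\lambda_1z^2}{1-\gamma_1z-\cfrac{\lambda_2z^2}{1-\gamma_2z-\cdots}}}. \]
   Context: $[m]_q=(1-q^m)/(1-q)$. A Ferrers diagram is a top- and left-justified array of unit cells with weakly decreasing row lengths (empty rows and columns allowed); its length is the number of rows plus the number of columns. For a Ferrers diagram $F$ with $k$ columns, the shifted diagram $\overline F$ is obtained by adding above $F$ $k$ new left-justified rows of lengths $1,2,\dots,k$ (top to bottom); the rightmost cell of an added row is a diagonal cell. The length of $\overline F$ is that of $F$. A type $B$ permutation tableau of length $n$ is a $0,1$-filling of such an $\overline F$ of length $n$ with (1) each column containing a $1$; (2) no $0$ having both a $1$ above it in its column and a $1$ to its left in its row; (3) no $0$ in a diagonal cell having a $1$ to its left in its row. $\mathrm{PT}_B(n)$ denotes the set of these. For $T$: $\operatorname{so}(T)$ is the number of $1$'s having a $1$ above them in the same column, $\operatorname{row}(T)$ the number of rows of $F$ (added rows excluded), $\operatorname{diag}(T)$ the number of $1$'s in diagonal cells. $B_n(y,t,q)=\sum_{T\in\mathrm{PT}_B(n)}y^{2\operatorname{row}(T)+\operatorname{diag}(T)}t^{\operatorname{diag}(T)}q^{\operatorname{so}(T)}$. *)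

theory Defs
  imports "HOL-Computational_Algebra.Formal_Power_Series" "HOL-Library.FuncSet"
begin

(* At q = 1 the quotient has a removable singularity; the value there is that of the
   polynomial 1 + q + ... + q^(m-1), see qint_eq_sum. *)
definition qint :: "'a::field \<Rightarrow> nat \<Rightarrow> 'a" where
  "qint q m = (if q = 1 then of_nat m else (1 - q ^ m) / (1 - q))"

lemma qint_eq_sum: "qint q m = (\<Sum>i<m. q ^ i)"
  by (simp add: qint_def sum_gp_strict)

(* A Ferrers diagram with k columns is given by k and the list of its row lengths.
   Row lengths may be 0 and the first may be smaller than k (empty rows and columns). *)
definition is_ferrers :: "nat \<Rightarrow> nat list \<Rightarrow> bool" where
  "is_ferrers k rs \<longleftrightarrow> sorted_wrt (\<ge>) rs \<and> (\<forall>r\<in>set rs. r \<le> k)"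

definition shifted_rows :: "nat \<Rightarrow> nat list \<Rightarrow> nat list" where
  "shifted_rows k rs = [1..<k + 1] @ rs"

(* Cells (i, j) = (row, column), counted from 0 from the top and from the left. *)
definition shifted_cells :: "nat \<Rightarrow> nat list \<Rightarrow> (nat \<times> nat) set" where
  "shifted_cells k rs =
     {(i, j). i < length (shifted_rows k rs) \<and> j < shifted_rows k rs ! i}"

(* The i-th row from the top (i < k) is an added row, of length i + 1. *)
definition diagonal_cells :: "nat \<Rightarrow> (nat \<times> nat) set" where
  "diagonal_cells k = {(i, i) | i. i < k}"

type_synonym filling = "nat \<times> nat \<Rightarrow> nat"

definition one_above :: "(nat \<times> nat) set \<Rightarrow> filling \<Rightarrow> nat \<times> nat \<Rightarrow> bool" where
  "one_above C f = (\<lambda>(i, j). \<exists>i'<i. (i', j) \<in> C \<and> f (i', j) = 1)"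

definition one_left :: "(nat \<times> nat) set \<Rightarrow> filling \<Rightarrow> nat \<times> nat \<Rightarrow> bool" where
  "one_left C f = (\<lambda>(i, j). \<exists>j'<j. (i, j') \<in> C \<and> f (i, j') = 1)"

(* The function space is extensional, so that a filling is determined by its values on
   the cells. *)
definition is_tableau_B :: "nat \<Rightarrow> nat list \<Rightarrow> filling \<Rightarrow> bool" where
  "is_tableau_B k rs f \<longleftrightarrow>
     (let C = shifted_cells k rs in
       is_ferrers k rs \<and>
       f \<in> C \<rightarrow>\<^sub>E {0, 1} \<and>
       (\<forall>j<k. \<exists>i. (i, j) \<in> C \<and> f (i, j) = 1) \<and>
       (\<forall>c\<in>C. f c = 0 \<longrightarrow> \<not> (one_above C f c \<and> one_left C f c)) \<and>
       (\<forall>c\<in>diagonal_cells k. f c = 0 \<longrightarrow> \<not> one_left C f c))"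

definition PT_B :: "nat \<Rightarrow> (nat \<times> nat list \<times> filling) set" where
  "PT_B n = {(k, rs, f). length rs + k = n \<and> is_tableau_B k rs f}"

definition so_stat :: "nat \<times> nat list \<times> filling \<Rightarrow> nat" where
  "so_stat = (\<lambda>(k, rs, f).
     card {c \<in> shifted_cells k rs. f c = 1 \<and> one_above (shifted_cells k rs) f c})"

definition row_stat :: "nat \<times> nat list \<times> filling \<Rightarrow> nat" where
  "row_stat = (\<lambda>(k, rs, f). length rs)"

definition diag_stat :: "nat \<times> nat list \<times> filling \<Rightarrow> nat" where
  "diag_stat = (\<lambda>(k, rs, f). card {c \<in> diagonal_cells k. f c = 1})"

lemma finite_PT_B: "finite (PT_B n)"
proof -
  have fin_cells: "finite (shifted_cells k rs)" for k rs
  proof -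
    have "shifted_cells k rs =
        (SIGMA i:{..<length (shifted_rows k rs)}. {..<shifted_rows k rs ! i})"
      by (auto simp: shifted_cells_def)
    then show ?thesis by simp
  qed
  let ?L = "{rs :: nat list. set rs \<subseteq> {..n} \<and> length rs \<le> n}"
  have "finite (SIGMA k:{..n}. SIGMA rs:?L. shifted_cells k rs \<rightarrow>\<^sub>E {0, 1 :: nat})"
    by (intro finite_SigmaI finite_lists_length_le finite_PiE fin_cells) auto
  moreover have "PT_B n \<subseteq>
      (SIGMA k:{..n}. SIGMA rs:?L. shifted_cells k rs \<rightarrow>\<^sub>E {0, 1 :: nat})"
  proof
    fix T assume "T \<in> PT_B n"
    then obtain k rs f where T: "T = (k, rs, f)" and len: "length rs + k = n"
      and le: "\<forall>r\<in>set rs. r \<le> k" and f: "f \<in> shifted_cells k rs \<rightarrow>\<^sub>E {0, 1}"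
      unfolding PT_B_def is_tableau_B_def is_ferrers_def Let_def by blast
    have "set rs \<subseteq> {..n}"
    proof
      fix r assume "r \<in> set rs"
      with le have "r \<le> k" by blast
      with len show "r \<in> {..n}" by simp
    qed
    moreover have "k \<le> n" "length rs \<le> n" using len by simp_all
    ultimately show
      "T \<in> (SIGMA k:{..n}. SIGMA rs:?L. shifted_cells k rs \<rightarrow>\<^sub>E {0, 1 :: nat})"
      unfolding T using f by blast
  qed
  ultimately show ?thesis by (rule finite_subset[rotated])
qed

definition B_poly :: "'a::field \<Rightarrow> 'a \<Rightarrow> 'a \<Rightarrow> nat \<Rightarrow> 'a" where
  "B_poly y t q n =
     (\<Sum>T\<in>PT_B n. y ^ (2 * row_stat T + diag_stat T) * t ^ diag_stat T * q ^ so_stat T)"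

(* J_convergent g l N h starts the continued fraction at level h and cuts it off after
   N further levels, so that the last denominator is 1 - g (h + N) z. *)
fun J_convergent :: "(nat \<Rightarrow> 'a::field) \<Rightarrow> (nat \<Rightarrow> 'a) \<Rightarrow> nat \<Rightarrow> nat \<Rightarrow> 'a fps" where
  "J_convergent g l 0 h = 1 / (1 - fps_const (g h) * fps_X)"
| "J_convergent g l (Suc N) h =
     1 / (1 - fps_const (g h) * fps_X
            - fps_const (l (Suc h)) * fps_X\<^sup>2 * J_convergent g l N (Suc h))"

(* The infinite continued fraction is the limit of its convergents in the library's
   metric on formal power series, i.e. coefficientwise stabilisation. *)
definition has_J_fraction :: "'a::field fps \<Rightarrow> (nat \<Rightarrow> 'a) \<Rightarrow> (nat \<Rightarrow> 'a) \<Rightarrow> bool" where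
  "has_J_fraction F g l \<longleftrightarrow> (\<lambda>N. J_convergent g l N 0) \<longlonglongrightarrow> F"

end

theory Submission
  imports Defs "HOL-Computational_Algebra.Polynomial"
begin

text \<open>Call a row of a tableau free if putting a 1 to its left violates neither (2) nor (3). Reading a
  tableau from its bottom left, either the last row is empty and can be removed, or the first column
  and the first added row can be removed. Which columns can be put back depends only on the number
  of free rows. With a variable X marking free rows, this turns the weighted count of the tableaux
  of length n into the value at X = 1 of the n-th iterate, started at 1, of the operator taking p to
  y^2 X p + y t X p(1 + q X) + X (p(X) - p(1 + q X)) / (X - 1 - q X).
  In the basis (X - [1])...(X - [h]) this operator is tridiagonal, and all basis elements but
  the first vanish at X = 1. After rescaling, its coefficients are 1, \<gamma> and \<lambda>, so the counts are
  the weights of Motzkin paths, whose generating function is the J-fraction.\<close>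

section \<open>J-fractions and weighted Motzkin paths\<close>

text \<open>The total weight of the Motzkin paths from height 0 to height h with n steps; all up steps have
  weight 1.\<close>

fun motzkin :: "(nat \<Rightarrow> 'a::field) \<Rightarrow> (nat \<Rightarrow> 'a) \<Rightarrow> nat \<Rightarrow> nat \<Rightarrow> 'a" where
  "motzkin g l 0 h = (if h = 0 then 1 else 0)"
| "motzkin g l (Suc n) h =
     (if h = 0 then 0 else motzkin g l n (h - 1)) + g h * motzkin g l n h
       + l (Suc h) * motzkin g l n (Suc h)"

lemma motzkin_eq_0: "n < h \<Longrightarrow> motzkin g l n h = 0"
  by (induction n arbitrary: h) auto

lemma motzkin_diag: "motzkin g l n n = 1"
  by (induction n) (auto simp: motzkin_eq_0)

text \<open>The power of z that divides the generating function of the paths ending at height h is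
  divided out, so that the constant term is 1 and consecutive quotients are the tails of the
  continued fraction.\<close>

definition motzkin_fps :: "(nat \<Rightarrow> 'a::field) \<Rightarrow> (nat \<Rightarrow> 'a) \<Rightarrow> nat \<Rightarrow> 'a fps" where
  "motzkin_fps g l h = Abs_fps (\<lambda>n. motzkin g l (n + h) h)"

text \<open>The last step is removed. A final down step accounts for one factor z; the second is the
  one divided out in \<open>motzkin_fps g l 1\<close>. For the same reason a final up step carries
  no z in the next lemma.\<close>

lemma motzkin_fps_0:
  "motzkin_fps g l 0 = 1 + fps_const (g 0) * fps_X * motzkin_fps g l 0
     + fps_const (l 1) * fps_X\<^sup>2 * motzkin_fps g l 1"
proof (rule fps_ext)
  fix n
  show "fps_nth (motzkin_fps g l 0) n = fps_nth (1 + fps_const (g 0) * fps_X * motzkin_fps g l 0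
     + fps_const (l 1) * fps_X\<^sup>2 * motzkin_fps g l 1) n"
    by (cases n; cases "n - 1")
      (auto simp: motzkin_fps_def mult.assoc fps_X_power_mult_nth)
qed

lemma motzkin_fps_Suc:
  "motzkin_fps g l (Suc h) = motzkin_fps g l h
     + fps_const (g (Suc h)) * fps_X * motzkin_fps g l (Suc h)
     + fps_const (l (Suc (Suc h))) * fps_X\<^sup>2 * motzkin_fps g l (Suc (Suc h))"
proof (rule fps_ext)
  fix n
  show "fps_nth (motzkin_fps g l (Suc h)) n = fps_nth (motzkin_fps g l h
     + fps_const (g (Suc h)) * fps_X * motzkin_fps g l (Suc h)
     + fps_const (l (Suc (Suc h))) * fps_X\<^sup>2 * motzkin_fps g l (Suc (Suc h))) n"
    by (cases n; cases "n - 1")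
      (auto simp: motzkin_fps_def mult.assoc fps_X_power_mult_nth motzkin_eq_0)
qed

text \<open>\<open>F h\<close> is a solution of the tail equations of the fraction. Two fractions
  that differ only in the tail below the first level differ by a multiple of z^2 times the
  difference of these tails, so each level gains at least one power of z.\<close>

lemma fps_X_power_dvd_J_convergent_diff:
  fixes F :: "nat \<Rightarrow> 'a::field fps"
  assumes F: "\<And>h. F h * (1 - fps_const (g h) * fps_X
                 - fps_const (l (Suc h)) * fps_X\<^sup>2 * F (Suc h)) = 1"
  shows "fps_X ^ N dvd (J_convergent g l N h - F h)"
proof (induction N arbitrary: h)
  case 0
  show ?case by simp
next
  case (Suc N)
  let ?J = "J_convergent g l (Suc N) h" and ?J' = "J_convergent g l N (Suc h)"
  let ?A = "1 - fps_const (g h) * fps_X - fps_const (l (Suc h)) * fps_X\<^sup>2 * ?J'"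
  let ?B = "1 - fps_const (g h) * fps_X - fps_const (l (Suc h)) * fps_X\<^sup>2 * F (Suc h)"
  have "fps_nth ?A 0 = 1" by (simp add: mult.assoc fps_X_power_mult_nth)
  then have "?J * ?A = 1" by (simp add: fps_divide_unit inverse_mult_eq_1)
  \<comment> \<open>Both \<open>?J * ?A\<close> and \<open>F h * ?B\<close> are 1, so
    \<open>?J * F h * (?B - ?A)\<close> telescopes.\<close>
  then have "?J - F h = ?J * F h * (?B - ?A)"
    using F[of h] by algebra
  also have "\<dots> = fps_X * (?J * F h * fps_const (l (Suc h)) * fps_X) * (?J' - F (Suc h))"
    by (simp add: power2_eq_square algebra_simps)
  finally show ?case
    using Suc[of "Suc h"] by (simp only: power_Suc mult.assoc) (intro mult_dvd_mono dvd_mult; simp)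
qed

lemma has_J_fraction_motzkin: "has_J_fraction (Abs_fps (\<lambda>n. motzkin g l n 0)) g l"
proof -
  define K where "K = motzkin_fps g l"
  \<comment> \<open>Dividing the recurrence for \<open>K h\<close> by \<open>K h\<close> shows that
    \<open>K h / K (h - 1)\<close> satisfies the tail equation at level h, where 1 takes the place
    of \<open>K (h - 1)\<close> for h = 0. The quotients exist because \<open>K h\<close> has
    constant term 1.\<close>
  define F where "F h = (case h of 0 \<Rightarrow> K 0 | Suc h' \<Rightarrow> K h * inverse (K h'))" for h
  have K0: "K h * inverse (K h) = 1" for h
    by (intro inverse_mult_eq_1') (simp add: K_def motzkin_fps_def motzkin_diag)
  have F: "F h * (1 - fps_const (g h) * fps_X
                 - fps_const (l (Suc h)) * fps_X\<^sup>2 * F (Suc h)) = 1" for h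
  proof (cases h)
    case 0
    have "K 0 * (1 - fps_const (g 0) * fps_X
        - fps_const (l 1) * fps_X\<^sup>2 * (K 1 * inverse (K 0)))
        = (K 0 - fps_const (g 0) * fps_X * K 0)
          - fps_const (l 1) * fps_X\<^sup>2 * K 1 * (K 0 * inverse (K 0))"
      by (simp add: algebra_simps)
    also have "\<dots> = 1"
      unfolding K0 using motzkin_fps_0[of g l] by (simp add: K_def algebra_simps)
    finally show ?thesis using 0 by (simp add: F_def)
  next
    case (Suc m)
    have Km: "K h - fps_const (g h) * fps_X * K h - fps_const (l (Suc h)) * fps_X\<^sup>2 * K (Suc h) = K m"
      using motzkin_fps_Suc[of g l m] Suc by (simp add: K_def algebra_simps)
    have "K h * inverse (K m) * (1 - fps_const (g h) * fps_X
        - fps_const (l (Suc h)) * fps_X\<^sup>2 * (K (Suc h) * inverse (K h)))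
        = (K h - fps_const (g h) * fps_X * K h
          - fps_const (l (Suc h)) * fps_X\<^sup>2 * K (Suc h) * (K h * inverse (K h))) * inverse (K m)"
      by (simp add: algebra_simps)
    also have "\<dots> = K m * inverse (K m)"
      by (simp add: K0 Km)
    finally show ?thesis using Suc K0 by (simp add: F_def)
  qed
  have *: "fps_nth (J_convergent g l N 0) n = fps_nth (F 0) n" if "n < N" for n N
  proof -
    obtain d where "J_convergent g l N 0 - F 0 = fps_X ^ N * d"
      using fps_X_power_dvd_J_convergent_diff[of F g l N 0, OF F] by (rule dvdE)
    then have "fps_nth (J_convergent g l N 0 - F 0) n = 0"
      using that by (simp only: fps_X_power_mult_nth if_True)
    then show ?thesis by simp
  qed
  have "(\<lambda>N. J_convergent g l N 0) \<longlonglongrightarrow> F 0"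
    by (intro tendsto_fpsI eventually_mono[OF eventually_gt_at_top] *)
  then show ?thesis
    by (simp add: has_J_fraction_def F_def K_def motzkin_fps_def)
qed

section \<open>The tridiagonal operator\<close>

lemma qint_Suc: "qint q (Suc m) = 1 + q * qint q m"
  by (simp add: qint_eq_sum sum.lessThan_Suc_shift sum_distrib_left del: sum.lessThan_Suc)

text \<open>The roots [1], [2], ... form an orbit of the map X to 1 + q X that the operator
  substitutes, so this substitution almost shifts the basis.\<close>

fun qbasis :: "'a::field \<Rightarrow> nat \<Rightarrow> 'a poly" where
  "qbasis q 0 = 1"
| "qbasis q (Suc h) = qbasis q h * [:- qint q (Suc h), 1:]"

lemma poly_qbasis_1: "poly (qbasis q h) 1 = (if h = 0 then 1 else 0)"
  by (induction h) (auto simp: qint_eq_sum)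

text \<open>By [m + 1] = 1 + q [m] the factor X - [m + 1] becomes q (X - [m]); the first factor X -
  [1] becomes q X.\<close>

lemma pcompose_qbasis_Suc:
  "pcompose (qbasis q (Suc h)) [:1, q:] = smult (q ^ Suc h) ([:0, 1:] * qbasis q h)"
proof (induction h)
  case 0
  show ?case by (simp add: pcompose_pCons qint_eq_sum)
next
  case (Suc h)
  have "pcompose [:- qint q (Suc (Suc h)), 1:] [:1, q:] = smult q [:- qint q (Suc h), 1:]"
    by (simp add: pcompose_pCons qint_Suc[of q "Suc h"])
  then show ?case
    by (subst qbasis.simps(2), subst pcompose_mult, subst Suc) (simp add: mult_ac smult_diff_right)
qed

text \<open>The operator described at the top, multiplied by X - 1 - q X, to avoid the division.\<close>

definition step_op :: "'a::field \<Rightarrow> 'a \<Rightarrow> 'a \<Rightarrow> 'a poly \<Rightarrow> 'a poly" where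
  "step_op y t q p = [:-1, 1 - q:] * smult (y\<^sup>2) ([:0, 1:] * p)
     + [:0, 1:] * ((smult (y * t) [:-1, 1 - q:] - 1) * pcompose p [:1, q:] + p)"

lemma step_op_0: "step_op y t q 0 = 0"
  by (simp add: step_op_def)

lemma step_op_add: "step_op y t q (p + r) = step_op y t q p + step_op y t q r"
  by (simp add: step_op_def pcompose_add algebra_simps smult_add_right)

lemma step_op_smult: "step_op y t q (smult c p) = smult c (step_op y t q p)"
  by (simp add: step_op_def pcompose_smult algebra_simps smult_add_right smult_diff_right)

lemma step_op_sum: "step_op y t q (sum f A) = (\<Sum>a\<in>A. step_op y t q (f a))"
  by (induction A rule: infinite_finite_induct) (auto simp: step_op_0 step_op_add)

lemma step_op_qbasis:
  "step_op y t q (qbasis q h) = [:-1, 1 - q:] *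
     (smult (y\<^sup>2 + y * t * q ^ h) (qbasis q (Suc h))
      + smult (y\<^sup>2 * qint q (h + 1) + qint q h + y * t * q ^ h * (qint q h + qint q (h + 1)))
          (qbasis q h)
      + (if h = 0 then 0 else smult ((qint q h)\<^sup>2 * (1 + y * t * q ^ h)) (qbasis q (h - 1))))"
proof (cases h)
  case 0
  then show ?thesis
    by (simp add: step_op_def qint_eq_sum pcompose_1 algebra_simps power2_eq_square)
next
  case (Suc m)
  define X :: "'a poly" where "X = [:0, 1:]"
  define \<theta> where "\<theta> = [:-1, 1 - q:]"
  define a where "a = qint q h"
  define b where "b = qint q (h + 1)"
  define Q where "Q = q ^ h"
  define P where "P = qbasis q m"
  have Ph: "qbasis q h = P * (X - [:a:])"
    by (simp add: Suc P_def X_def a_def)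
  have PSh: "qbasis q (Suc h) = P * (X - [:a:]) * (X - [:b:])"
    by (simp add: Suc P_def X_def a_def b_def)
  have comp: "pcompose (qbasis q h) [:1, q:] = [:Q:] * X * P"
    unfolding Suc by (subst pcompose_qbasis_Suc) (simp add: Suc X_def Q_def P_def)
  \<comment> \<open>This is (1 - q) [h] = 1 - q^h. It makes p(X) - p(1 + q X) equal to
    \<open>\<theta>\<close> times \<open>[:a:] * P\<close> for the basis element p, so that
    \<open>\<theta>\<close> can be factored out exactly.\<close>
  have \<theta>: "[:a:] * \<theta> = X - [:a:] - [:Q:] * X"
    by (cases "q = 1") (auto simp: \<theta>_def X_def a_def Q_def qint_def field_simps)
  have s: "smult c p = [:c:] * p" for c :: 'a and p by simp
  have c: "[:u * v:] = [:u:] * [:v:]" "[:u + v:] = [:u:] + [:v:]" "[:1::'a:] = 1" for u v :: 'a by simp_all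
  have "step_op y t q (qbasis q h) = \<theta> * ([:y\<^sup>2:] * (X * qbasis q h))
      + X * (([:y * t:] * \<theta> - 1) * pcompose (qbasis q h) [:1, q:] + qbasis q h)"
    unfolding step_op_def X_def \<theta>_def by simp
  also have "\<dots> = \<theta> * ([:y\<^sup>2:] * (X * (P * (X - [:a:]))))
      + X * (([:y:] * [:t:] * \<theta> - 1) * ([:Q:] * X * P) + P * (X - [:a:]))"
    unfolding comp unfolding Ph by (simp only: c)
  also have "\<dots> = \<theta> * ([:y\<^sup>2:] * X * P * (X - [:a:]) + [:y:] * [:t:] * [:Q:] * X * X * P
      + [:a:] * X * P)"
    using \<theta> by algebra
  \<comment> \<open>Re-expansion in 1, X - a, (X - a)(X - b), using X = a + (X - a) = b + (X - b)
    and X^2 = a^2 + (a + b)(X - a) + (X - a)(X - b).\<close>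
  also have "\<dots> = \<theta> * (([:y\<^sup>2:] + [:y:] * [:t:] * [:Q:]) * (P * (X - [:a:]) * (X - [:b:]))
      + ([:y\<^sup>2:] * [:b:] + [:a:] + [:y:] * [:t:] * [:Q:] * ([:a:] + [:b:])) * (P * (X - [:a:]))
      + [:a:] * [:a:] * (1 + [:y:] * [:t:] * [:Q:]) * P)"
    by algebra
  finally show ?thesis
    unfolding PSh Ph s c \<theta>_def[symmetric] a_def[symmetric] b_def[symmetric] Q_def[symmetric] power2_eq_square
    using Suc by (simp add: P_def)
qed


text \<open>Scaling the h-th basis element by the first h up coefficients makes every up coefficient
  1; the one from h - 1 to h moves into the down coefficient at h, giving \<open>l h\<close>. None
  is inverted, so some may be 0. The coordinates of \<open>P n\<close> in the scaled family then
  follow the recursion of \<open>motzkin\<close>, and only index 0 survives at X = 1.\<close>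

lemma step_op_iterates:
  fixes P :: "nat \<Rightarrow> 'a::field poly"
  assumes P0: "P 0 = 1" and PSuc: "\<And>n. [:-1, 1 - q:] * P (Suc n) = step_op y t q (P n)"
    and g: "\<And>h. g h = y\<^sup>2 * qint q (h + 1) + qint q h
                    + y * t * q ^ h * (qint q h + qint q (h + 1))"
    and l: "\<And>h. h \<ge> 1 \<Longrightarrow>
           l h = y * (qint q h)\<^sup>2 * (y + t * q ^ (h - 1)) * (1 + y * t * q ^ h)"
  shows "poly (P n) 1 = motzkin g l n 0"
proof -
  define N where "N h = smult (\<Prod>i<h. y\<^sup>2 + y * t * q ^ i) (qbasis q h)" for h
  define M where "M = motzkin g l"
  define \<theta> where "\<theta> = [:-1, 1 - q:]"
  have step: "step_op y t q (N h) = [:-1, 1 - q:] * (N (Suc h) + smult (g h) (N h)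
      + (if h = 0 then 0 else smult (l h) (N (h - 1))))" for h
  proof (cases h)
    case 0
    then show ?thesis
      unfolding N_def step_op_smult step_op_qbasis by (simp add: g)
  next
    case (Suc m)
    have "(y\<^sup>2 + y * t * q ^ m) * ((qint q h)\<^sup>2 * (1 + y * t * q ^ h)) = l h"
      using l[of h] Suc by (simp add: power2_eq_square algebra_simps)
    moreover have "(\<Prod>i<h. y\<^sup>2 + y * t * q ^ i)
        = (\<Prod>i<m. y\<^sup>2 + y * t * q ^ i) * (y\<^sup>2 + y * t * q ^ m)"
      by (simp add: Suc)
    ultimately have *: "(\<Prod>i<h. y\<^sup>2 + y * t * q ^ i) * ((qint q h)\<^sup>2 * (1 + y * t * q ^ h))
        = l h * (\<Prod>i<m. y\<^sup>2 + y * t * q ^ i)"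
      by (simp only: mult_ac flip: \<open>_ = l h\<close>)
    have h: "h \<noteq> 0" "h - 1 = m" using Suc by simp_all
    define c where "c = (\<Prod>i<h. y\<^sup>2 + y * t * q ^ i)"
    have "step_op y t q (N h) = [:-1, 1 - q:] * (smult c (smult (y\<^sup>2 + y * t * q ^ h) (qbasis q (Suc h)))
        + smult c (smult (g h) (qbasis q h))
        + smult c (smult ((qint q h)\<^sup>2 * (1 + y * t * q ^ h)) (qbasis q m)))"
      unfolding N_def step_op_smult step_op_qbasis g c_def[symmetric]
      by (simp only: smult_add_right mult_smult_right[symmetric] h if_False)
    also have "smult c (smult (y\<^sup>2 + y * t * q ^ h) (qbasis q (Suc h))) = N (Suc h)"
      by (simp only: smult_smult N_def c_def prod.lessThan_Suc)
    also have "smult c (smult (g h) (qbasis q h)) = smult (g h) (N h)"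
      by (simp only: smult_smult N_def c_def mult.commute)
    also have "smult c (smult ((qint q h)\<^sup>2 * (1 + y * t * q ^ h)) (qbasis q m))
        = smult (l h) (N m)"
      by (simp only: smult_smult N_def c_def *)
    finally show ?thesis
      by (simp only: h if_False)
  qed
  have expand: "P n = (\<Sum>h\<le>n. smult (M n h) (N h))" for n
  proof (induction n)
    case 0
    show ?case by (simp add: P0 M_def N_def)
  next
    case (Suc n)
    have "[:-1, 1 - q:] * P (Suc n) = (\<Sum>h\<le>n. smult (M n h) (step_op y t q (N h)))"
      by (simp only: PSuc Suc step_op_sum step_op_smult)
    also have "\<dots> = [:-1, 1 - q:] * ((\<Sum>h\<le>n. smult (M n h) (N (Suc h)))
        + (\<Sum>h\<le>n. smult (M n h * g h) (N h))
        + (\<Sum>h\<le>n. if h = 0 then 0 else smult (M n h * l h) (N (h - 1))))"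
      unfolding step sum_distrib_left sum.distrib[symmetric] \<theta>_def[symmetric]
      by (intro sum.cong refl) (simp add: smult_add_right algebra_simps)
    also have "(\<Sum>h\<le>n. smult (M n h) (N (Suc h)))
        = (\<Sum>h\<le>Suc n. smult (if h = 0 then 0 else M n (h - 1)) (N h))"
      by (subst sum.atMost_Suc_shift) simp
    \<comment> \<open>\<open>M n h\<close> is 0 for h > n, so all three sums can be brought to the
      range up to \<open>Suc n\<close>; the last is first extended to \<open>Suc (Suc n)\<close>
      because the shift of index shortens it by one.\<close>
    also have "(\<Sum>h\<le>n. smult (M n h * g h) (N h)) = (\<Sum>h\<le>Suc n. smult (M n h * g h) (N h))"
      by (simp add: M_def motzkin_eq_0)
    also have "(\<Sum>h\<le>n. if h = 0 then 0 else smult (M n h * l h) (N (h - 1)))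
        = (\<Sum>h\<le>Suc (Suc n). if h = 0 then 0 else smult (M n h * l h) (N (h - 1)))"
      by (simp add: M_def motzkin_eq_0)
    also have "\<dots> = (\<Sum>h\<le>Suc n. smult (M n (Suc h) * l (Suc h)) (N h))"
      by (subst sum.atMost_Suc_shift) simp
    also have "(\<Sum>h\<le>Suc n. smult (if h = 0 then 0 else M n (h - 1)) (N h))
        + (\<Sum>h\<le>Suc n. smult (M n h * g h) (N h)) + \<dots> = (\<Sum>h\<le>Suc n. smult (M (Suc n) h) (N h))"
      unfolding sum.distrib[symmetric]
      by (intro sum.cong refl) (simp add: M_def smult_add_left[symmetric] mult_ac)
    \<comment> \<open>The common factor has constant coefficient -1, hence is nonzero for every q
      and cancels.\<close>
    finally show ?case
      by (subst (asm) mult_cancel_left) auto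
  qed
  have "poly (P n) 1 = (\<Sum>h\<le>n. if h = 0 then M n h else 0)"
    unfolding expand poly_sum by (intro sum.cong refl) (simp add: N_def poly_qbasis_1)
  then show ?thesis by (simp add: sum.delta M_def)
qed

section \<open>Weights of a new first column\<close>

lemma sum_Pow_card:
  fixes q x :: "'a::comm_ring_1"
  assumes "finite A"
  shows "(\<Sum>S\<in>Pow A. q ^ card S * x ^ card S) = (1 + q * x) ^ card A"
  using prod_add[OF assms, of "\<lambda>_. q * x" "\<lambda>_. 1"]
  by (simp add: power_mult_distrib add.commute)

text \<open>A stands for the free rows and S for the rows of the 1's in a new column; the rows free
  afterwards are those in S and those above the topmost 1. Let W be the sum for A, and let b be a
  new largest element. Subsets without b give W, nonempty ones enlarged by b give q x W, and {b}
  gives x^(|A| + 1). The resulting recursion is that of a geometric sum with ratio between x and 1 +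
  q x, hence the factor x - 1 - q x.\<close>

lemma sum_nonempty_subsets:
  fixes q x :: "'a::comm_ring_1" and A :: "'b::linorder set"
  assumes "finite A"
  shows "(x - 1 - q * x) * (\<Sum>S\<in>Pow A - {{}}. q ^ (card S - 1)
             * x ^ (card S + card {r\<in>A. \<forall>s\<in>S. r < s}))
           = x * (x ^ card A - (1 + q * x) ^ card A)"
  using assms
proof (induction A rule: finite_linorder_max_induct)
  case empty
  show ?case by simp
next
  case (insert b A)
  define W where "W = (\<Sum>S\<in>Pow A - {{}}. q ^ (card S - 1)
             * x ^ (card S + card {r\<in>A. \<forall>s\<in>S. r < s}))"
  let ?f = "\<lambda>S. q ^ (card S - 1) * x ^ (card S + card {r\<in>insert b A. \<forall>s\<in>S. r < s})"
  have b: "b \<notin> A" using insert by auto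
  have "(\<Sum>S\<in>Pow (insert b A) - {{}}. ?f S)
      = (\<Sum>S\<in>(Pow A - {{}}) \<union> insert b ` Pow A. ?f S)"
    by (rule arg_cong[of _ _ "sum ?f"]) (auto simp: Pow_insert)
  also have "\<dots> = (\<Sum>S\<in>Pow A - {{}}. ?f S) + (\<Sum>S\<in>insert b ` Pow A. ?f S)"
    using b insert by (intro sum.union_disjoint) auto
  also have "(\<Sum>S\<in>Pow A - {{}}. ?f S) = W"
    unfolding W_def
  proof (intro sum.cong refl)
    fix S assume "S \<in> Pow A - {{}}"
    \<comment> \<open>As S is nonempty and b exceeds all its elements, b is not below all of
      S.\<close>
    then have "{r \<in> insert b A. \<forall>s\<in>S. r < s} = {r \<in> A. \<forall>s\<in>S. r < s}"
      using insert by force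
    then show "?f S = q ^ (card S - 1) * x ^ (card S + card {r\<in>A. \<forall>s\<in>S. r < s})" by simp
  qed
  also have "(\<Sum>S\<in>insert b ` Pow A. ?f S) = (\<Sum>S\<in>Pow A. ?f (insert b S))"
    using b by (subst sum.reindex) (auto simp: inj_on_def)
  also have "\<dots> = ?f {b} + (\<Sum>S\<in>Pow A - {{}}. ?f (insert b S))"
    using insert by (subst sum.remove[of _ "{}"]) auto
  also have "(\<Sum>S\<in>Pow A - {{}}. ?f (insert b S)) = q * x * W"
    unfolding W_def sum_distrib_left
  proof (intro sum.cong refl)
    fix S assume S: "S \<in> Pow A - {{}}"
    then have "{r \<in> insert b A. \<forall>s\<in>insert b S. r < s} = {r \<in> A. \<forall>s\<in>S. r < s}"
      using insert by force
    moreover have S': "finite S" "b \<notin> S" "S \<noteq> {}"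
      using S b insert by (auto intro: finite_subset)
    then obtain m where "card S = Suc m"
      by (metis card_eq_0_iff old.nat.exhaust)
    moreover from this S' have "card (insert b S) = Suc (Suc m)"
      by simp
    ultimately show "?f (insert b S)
        = q * x * (q ^ (card S - 1) * x ^ (card S + card {r\<in>A. \<forall>s\<in>S. r < s}))"
      by (simp add: mult_ac)
  qed
  also have "{r \<in> insert b A. \<forall>s\<in>{b}. r < s} = A"
    using insert by auto
  finally have "(x - 1 - q * x) * (\<Sum>S\<in>Pow (insert b A) - {{}}. ?f S)
      = (1 + q * x) * ((x - 1 - q * x) * W) + (x - 1 - q * x) * x ^ Suc (card A)"
    by (simp add: algebra_simps)
  also have "(x - 1 - q * x) * W = x * (x ^ card A - (1 + q * x) ^ card A)"
    using insert by (simp add: W_def)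
  finally show ?case using b insert by (simp add: algebra_simps)
qed

text \<open>Index 0 is the new added row, whose only cell is diagonal; a 1 there has the extra
  weight c. It is then the topmost 1, no row lies above it, and the remaining 1's are summed by the
  binomial theorem. Without it the row 0 is not free, and the previous lemma applies.\<close>

lemma sum_column_weights:
  fixes c q x :: "'a::comm_ring_1" and A :: "nat set"
  assumes A: "finite A" "0 \<notin> A"
  shows "(x - 1 - q * x) * (\<Sum>S\<in>Pow (insert 0 A) - {{}}. c ^ of_bool (0 \<in> S) * q ^ (card S - 1)
             * x ^ (card S + card {r\<in>A. \<forall>s\<in>S. r < s}))
           = x * ((c * (x - 1 - q * x) - 1) * (1 + q * x) ^ card A + x ^ card A)"
proof -
  let ?f = "\<lambda>S. c ^ of_bool (0 \<in> S) * q ^ (card S - 1)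
             * x ^ (card S + card {r\<in>A. \<forall>s\<in>S. r < s})"
  have inj: "inj_on (insert 0) (Pow A)"
    using A by (intro inj_on_inverseI[of _ "\<lambda>S. S - {0}"]) auto
  have "sum ?f (Pow (insert 0 A) - {{}}) = sum ?f ((Pow A - {{}}) \<union> insert 0 ` Pow A)"
    by (rule arg_cong[of _ _ "sum ?f"]) (auto simp: Pow_insert)
  also have "\<dots> = sum ?f (Pow A - {{}}) + sum ?f (insert 0 ` Pow A)"
    using A by (intro sum.union_disjoint) auto
  also have "sum ?f (Pow A - {{}}) = (\<Sum>S\<in>Pow A - {{}}. q ^ (card S - 1)
             * x ^ (card S + card {r\<in>A. \<forall>s\<in>S. r < s}))"
    using A by (intro sum.cong) auto
  also have "sum ?f (insert 0 ` Pow A) = (\<Sum>S\<in>Pow A. ?f (insert 0 S))"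
    using inj by (subst sum.reindex) simp_all
  also have "\<dots> = (\<Sum>S\<in>Pow A. c * x * (q ^ card S * x ^ card S))"
  proof (intro sum.cong refl)
    fix S assume S: "S \<in> Pow A"
    then have "card (insert 0 S) = Suc (card S)"
      using A by (intro card_insert_disjoint) (auto simp: finite_subset)
    then show "?f (insert 0 S) = c * x * (q ^ card S * x ^ card S)"
      by simp
  qed
  also have "\<dots> = c * x * (1 + q * x) ^ card A"
    using sum_Pow_card[OF A(1), of q x] by (simp add: sum_distrib_left[symmetric])
  finally show ?thesis
    using sum_nonempty_subsets[OF A(1), of x q] by (simp add: algebra_simps)
qed

section \<open>Adding a row or a column to a tableau\<close>

text \<open>The clause on \<open>f (i, i)\<close> reflects condition (3), the one on
  \<open>one_above\<close> condition (2). Empty rows of F are free.\<close>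

definition free_rows :: "nat \<times> nat list \<times> filling \<Rightarrow> nat set" where
  "free_rows = (\<lambda>(k, rs, f). let C = shifted_cells k rs in
     {i. i < k + length rs \<and> \<not> (i < k \<and> f (i, i) = 0) \<and>
         (\<forall>j. (i, j) \<in> C \<and> f (i, j) = 0 \<longrightarrow> \<not> one_above C f (i, j))})"

lemma finite_free_rows: "finite (free_rows T)"
  by (cases T) (auto simp: free_rows_def Let_def)

lemma finite_shifted_cells: "finite (shifted_cells k rs)"
proof -
  have "shifted_cells k rs =
      (SIGMA i:{..<length (shifted_rows k rs)}. {..<shifted_rows k rs ! i})"
    by (auto simp: shifted_cells_def)
  then show ?thesis by simp
qed

definition add_row :: "nat \<times> nat list \<times> filling \<Rightarrow> nat \<times> nat list \<times> filling" where
  "add_row = (\<lambda>(k, rs, f). (k, rs @ [0], f))"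

lemma shifted_cells_append_0: "shifted_cells k (rs @ [0]) = shifted_cells k rs"
  by (auto simp: shifted_cells_def shifted_rows_def nth_append less_Suc_eq split: if_splits)

lemma is_tableau_B_append_0: "is_tableau_B k (rs @ [0]) f \<longleftrightarrow> is_tableau_B k rs f"
  by (auto simp: is_tableau_B_def is_ferrers_def shifted_cells_append_0 sorted_wrt_append Let_def)

lemma shifted_cells_bound: "(i, j) \<in> shifted_cells k rs \<Longrightarrow> i < k + length rs"
  by (auto simp: shifted_cells_def shifted_rows_def simp del: upt_Suc)

lemma free_rows_add_row:
  "free_rows (k, rs @ [0], f) = insert (k + length rs) (free_rows (k, rs, f))"
  by (auto simp: free_rows_def shifted_cells_append_0 Let_def dest: shifted_cells_bound)

section \<open>Prepending a first column together with a new top added row\<close>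

lemma shifted_cells_map_Suc:
  "(i, j) \<in> shifted_cells (Suc k) (map Suc rs) \<longleftrightarrow>
     (case j of 0 \<Rightarrow> i \<le> k + length rs
      | Suc j' \<Rightarrow> (case i of 0 \<Rightarrow> False | Suc i' \<Rightarrow> (i', j') \<in> shifted_cells k rs))"
proof -
  \<comment> \<open>Old added rows and rows of F all grow by one cell, and the new added row of
    length 1 comes on top. The old diagram thus moves by (1, 1), and column 0 meets every
    row.\<close>
  have "shifted_rows (Suc k) (map Suc rs) = 1 # map Suc (shifted_rows k rs)"
    by (simp add: shifted_rows_def upt_conv_Cons map_Suc_upt del: upt_Suc)
  moreover have "length (shifted_rows k rs) = k + length rs"
    by (simp add: shifted_rows_def)
  ultimately show ?thesis
    unfolding shifted_cells_def by (cases i; cases j) auto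
qed

lemma shifted_cells_map_Suc_simps:
  "(i, 0) \<in> shifted_cells (Suc k) (map Suc rs) \<longleftrightarrow> i \<le> k + length rs"
  "(0, Suc j) \<notin> shifted_cells (Suc k) (map Suc rs)"
  "(Suc i, Suc j) \<in> shifted_cells (Suc k) (map Suc rs) \<longleftrightarrow> (i, j) \<in> shifted_cells k rs"
  by (simp_all add: shifted_cells_map_Suc)

lemma all_nat_pair_iff:
  "(\<forall>c. P c) \<longleftrightarrow> (\<forall>i. P (i, 0)) \<and> (\<forall>j. P (0, Suc j)) \<and> (\<forall>i j. P (Suc i, Suc j))"
  for P :: "nat \<times> nat \<Rightarrow> bool"
  by (metis old.nat.exhaust surj_pair)

text \<open>Here f' is the filling f with one more column on the left, whose 1's are in the rows S, and
  one more added row on top.\<close>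

context
  fixes k :: nat and rs :: "nat list" and f' f :: filling and S :: "nat set"
  assumes f: "\<And>i j. f' (Suc i, Suc j) = f (i, j)"
    and S: "S = {i. i \<le> k + length rs \<and> f' (i, 0) = 1}"
begin

lemma one_above_map_Suc_simps:
  "one_above (shifted_cells (Suc k) (map Suc rs)) f' (i, 0) \<longleftrightarrow> (\<exists>i'\<in>S. i' < i)"
  "one_above (shifted_cells (Suc k) (map Suc rs)) f' (Suc i, Suc j)
     \<longleftrightarrow> one_above (shifted_cells k rs) f (i, j)"
proof -
  show "one_above (shifted_cells (Suc k) (map Suc rs)) f' (i, 0) \<longleftrightarrow> (\<exists>i'\<in>S. i' < i)"
    by (auto simp: one_above_def shifted_cells_map_Suc_simps S)
  have "(\<exists>i'<Suc i. P i') \<longleftrightarrow> P 0 \<or> (\<exists>i'<i. P (Suc i'))" for P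
    using less_Suc_eq_0_disj by auto
  then show "one_above (shifted_cells (Suc k) (map Suc rs)) f' (Suc i, Suc j)
     \<longleftrightarrow> one_above (shifted_cells k rs) f (i, j)"
    by (simp add: one_above_def shifted_cells_map_Suc_simps f)
qed

lemma one_left_map_Suc_simps:
  "\<not> one_left (shifted_cells (Suc k) (map Suc rs)) f' (i, 0)"
  "one_left (shifted_cells (Suc k) (map Suc rs)) f' (Suc i, Suc j)
     \<longleftrightarrow> Suc i \<in> S \<or> one_left (shifted_cells k rs) f (i, j)"
proof -
  show "\<not> one_left (shifted_cells (Suc k) (map Suc rs)) f' (i, 0)"
    by (auto simp: one_left_def)
  have "(\<exists>j'<Suc j. P j') \<longleftrightarrow> P 0 \<or> (\<exists>j'<j. P (Suc j'))" for P
    using less_Suc_eq_0_disj by auto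
  then show "one_left (shifted_cells (Suc k) (map Suc rs)) f' (Suc i, Suc j)
     \<longleftrightarrow> Suc i \<in> S \<or> one_left (shifted_cells k rs) f (i, j)"
    by (simp add: one_left_def shifted_cells_map_Suc_simps f S)
qed

lemma filling_map_Suc_iff:
  "f' \<in> shifted_cells (Suc k) (map Suc rs) \<rightarrow>\<^sub>E {0, 1} \<longleftrightarrow>
     f \<in> shifted_cells k rs \<rightarrow>\<^sub>E {0, 1} \<and> (\<forall>i\<le>k + length rs. f' (i, 0) \<in> {0, 1}) \<and>
     (\<forall>i>k + length rs. f' (i, 0) = undefined) \<and> (\<forall>j. f' (0, Suc j) = undefined)"
proof -
  have PiE: "g \<in> A \<rightarrow>\<^sub>E B \<longleftrightarrow> (\<forall>c. if c \<in> A then g c \<in> B else g c = undefined)"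
    for g :: filling and A B
    by (auto simp: PiE_iff extensional_def)
  have split: "(\<forall>i. if i \<le> n then P i else Q i) \<longleftrightarrow> (\<forall>i\<le>n. P i) \<and> (\<forall>i>n. Q i)"
    for n :: nat and P Q
    by (metis linorder_not_le)
  have outside: "((0, Suc j) \<in> shifted_cells (Suc k) (map Suc rs)) = False" for j
    by (simp add: shifted_cells_map_Suc_simps)
  show ?thesis
    unfolding PiE all_nat_pair_iff[of "\<lambda>c. if c \<in> shifted_cells (Suc k) (map Suc rs) then _ c else _ c"]
      shifted_cells_map_Suc_simps(1,3) outside f split_paired_All split if_False
    by (intro iffI conjI; elim conjE; assumption)
qed

text \<open>Cells of column 0 have nothing to their left, and the new top row has no cell above an
  old column. So the new 1's affect (2) and (3) only as 1's to the left of old cells, which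
  restricts them to free rows and the new row 0; condition (1) for the new column is
  \<open>S \<noteq> {}\<close>.\<close>

lemma is_tableau_B_map_Suc:
  "is_tableau_B (Suc k) (map Suc rs) f' \<longleftrightarrow>
     is_tableau_B k rs f \<and> (\<forall>i\<le>k + length rs. f' (i, 0) \<in> {0, 1}) \<and>
     (\<forall>i>k + length rs. f' (i, 0) = undefined) \<and> (\<forall>j. f' (0, Suc j) = undefined) \<and>
     S \<noteq> {} \<and> S \<subseteq> insert 0 (Suc ` free_rows (k, rs, f))"
proof -
  let ?C' = "shifted_cells (Suc k) (map Suc rs)" and ?C = "shifted_cells k rs"
  have ex0: "(\<exists>i. P i) \<longleftrightarrow> P 0 \<or> (\<exists>i. P (Suc i))" for P
    by (metis old.nat.exhaust)
  have ferrers: "is_ferrers (Suc k) (map Suc rs) \<longleftrightarrow> is_ferrers k rs"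
    by (simp add: is_ferrers_def sorted_wrt_map)
  have col: "(\<forall>j<Suc k. \<exists>i. (i, j) \<in> ?C' \<and> f' (i, j) = 1) \<longleftrightarrow>
      S \<noteq> {} \<and> (\<forall>j<k. \<exists>i. (i, j) \<in> ?C \<and> f (i, j) = 1)"
    unfolding All_less_Suc2 by (subst (2) ex0) (auto simp: shifted_cells_map_Suc_simps f S)
  have zero: "(\<forall>c\<in>?C'. f' c = 0 \<longrightarrow> \<not> (one_above ?C' f' c \<and> one_left ?C' f' c)) \<longleftrightarrow>
      (\<forall>c\<in>?C. f c = 0 \<longrightarrow> \<not> (one_above ?C f c \<and> one_left ?C f c)) \<and>
      (\<forall>i j. (i, j) \<in> ?C \<and> f (i, j) = 0 \<and> Suc i \<in> S \<longrightarrow> \<not> one_above ?C f (i, j))"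
    unfolding Ball_def all_nat_pair_iff[of "\<lambda>c. c \<in> ?C' \<longrightarrow> _ c"]
    by (auto simp: shifted_cells_map_Suc_simps one_above_map_Suc_simps one_left_map_Suc_simps f)
  have diag: "(\<forall>c\<in>diagonal_cells (Suc k). f' c = 0 \<longrightarrow> \<not> one_left ?C' f' c) \<longleftrightarrow>
      (\<forall>c\<in>diagonal_cells k. f c = 0 \<longrightarrow> \<not> one_left ?C f c) \<and>
      (\<forall>i<k. f (i, i) = 0 \<longrightarrow> Suc i \<notin> S)"
  proof -
    have "(\<forall>c\<in>diagonal_cells k. P c) \<longleftrightarrow> (\<forall>i<k. P (i, i))" for P k
      by (auto simp: diagonal_cells_def)
    then show ?thesis
      by (auto simp: All_less_Suc2 one_left_map_Suc_simps f)
  qed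
  have bound: "i < k + length rs" if "Suc i \<in> S" for i
    using that by (simp add: S)
  have "S \<subseteq> insert 0 (Suc ` A) \<longleftrightarrow> (\<forall>i. Suc i \<in> S \<longrightarrow> i \<in> A)" for A
  proof
    assume *: "\<forall>i. Suc i \<in> S \<longrightarrow> i \<in> A"
    show "S \<subseteq> insert 0 (Suc ` A)"
    proof
      fix i assume "i \<in> S"
      with * show "i \<in> insert 0 (Suc ` A)" by (cases i) auto
    qed
  qed auto
  then have sub: "S \<subseteq> insert 0 (Suc ` free_rows (k, rs, f)) \<longleftrightarrow>
      (\<forall>i j. (i, j) \<in> ?C \<and> f (i, j) = 0 \<and> Suc i \<in> S \<longrightarrow> \<not> one_above ?C f (i, j)) \<and>
      (\<forall>i<k. f (i, i) = 0 \<longrightarrow> Suc i \<notin> S)"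
    using bound by (auto simp: free_rows_def Let_def)
  show ?thesis
    unfolding is_tableau_B_def Let_def ferrers filling_map_Suc_iff col zero diag sub
    by (intro iffI conjI; elim conjE; assumption)
qed

text \<open>A free row stays free unless its new cell is a 0 with a 1 above it, that is, unless it
  lies below the topmost new 1 and is not in S. Row 0 is free exactly if its diagonal cell holds a
  1.\<close>

lemma free_rows_map_Suc:
  assumes "\<forall>i\<le>k + length rs. f' (i, 0) \<in> {0, 1}" "S \<subseteq> insert 0 (Suc ` free_rows (k, rs, f))"
  shows "free_rows (Suc k, map Suc rs, f') = S \<union> {r \<in> Suc ` free_rows (k, rs, f). \<forall>s\<in>S. r < s}"
proof (rule set_eqI)
  fix r
  have all0: "(\<forall>j. P j) \<longleftrightarrow> P 0 \<and> (\<forall>j. P (Suc j))" for P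
    by (metis old.nat.exhaust)
  show "r \<in> free_rows (Suc k, map Suc rs, f') \<longleftrightarrow>
      r \<in> S \<union> {r \<in> Suc ` free_rows (k, rs, f). \<forall>s\<in>S. r < s}"
  proof (cases r)
    case 0
    have "f' (0, 0) = 0 \<longleftrightarrow> 0 \<notin> S"
      using assms(1) by (auto simp: S)
    then show ?thesis
      unfolding free_rows_def Let_def 0 by (subst all0) (auto simp: shifted_cells_map_Suc_simps one_above_map_Suc_simps)
  next
    case (Suc i)
    have "r \<in> free_rows (Suc k, map Suc rs, f') \<longleftrightarrow>
        i \<in> free_rows (k, rs, f) \<and> (Suc i \<notin> S \<longrightarrow> \<not> (\<exists>s\<in>S. s < Suc i))"
    proof (cases "i < k + length rs")
      case True
      then have "f' (Suc i, 0) \<in> {0, 1}"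
        using assms(1) by (meson Suc_leI)
      then have f0: "f' (Suc i, 0) = (if Suc i \<in> S then 1 else 0)"
        using True by (auto simp: S)
      show ?thesis
        unfolding free_rows_def Let_def Suc mem_Collect_eq case_prod_conv
        by (subst all0) (use True in \<open>auto simp: shifted_cells_map_Suc_simps one_above_map_Suc_simps f f0\<close>)
    next
      case False
      then show ?thesis by (simp add: free_rows_def Let_def Suc)
    qed
    moreover have "Suc i \<in> S \<Longrightarrow> i \<in> free_rows (k, rs, f)"
      using assms(2) by auto
    moreover have "Suc i \<notin> S \<Longrightarrow> (\<not> (\<exists>s\<in>S. s < Suc i)) \<longleftrightarrow> (\<forall>s\<in>S. Suc i < s)"
      by (metis linorder_neqE_nat not_less_iff_gr_or_eq)
    ultimately show ?thesis using Suc by auto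
  qed
qed

lemma so_stat_map_Suc:
  assumes "S \<noteq> {}"
  shows "so_stat (Suc k, map Suc rs, f') = so_stat (k, rs, f) + (card S - 1)"
proof -
  let ?C' = "shifted_cells (Suc k) (map Suc rs)" and ?C = "shifted_cells k rs"
  let ?A = "{c \<in> ?C. f c = 1 \<and> one_above ?C f c}"
  have finS: "finite S" by (simp add: S)
  \<comment> \<open>Old cells keep their status; in the new column every 1 counts except the topmost
    one, in row \<open>Min S\<close>.\<close>
  have "{c \<in> ?C'. f' c = 1 \<and> one_above ?C' f' c}
      = map_prod Suc Suc ` ?A \<union> (\<lambda>s. (s, 0)) ` (S - {Min S})" (is "?L = ?R")
  proof (rule set_eqI)
    fix c :: "nat \<times> nat"
    obtain i j where c: "c = (i, j)" by (cases c)
    show "c \<in> ?L \<longleftrightarrow> c \<in> ?R"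
    proof (cases j)
      case 0
      have "(\<exists>i'\<in>S. i' < i) \<longleftrightarrow> i \<noteq> Min S" if "i \<in> S"
        using that finS by (metis Min_in Min_le assms less_le not_less)
      then show ?thesis
        unfolding c 0 by (auto simp: shifted_cells_map_Suc_simps one_above_map_Suc_simps S)
    next
      case (Suc j')
      then show ?thesis
        unfolding c by (cases i) (auto simp: shifted_cells_map_Suc_simps one_above_map_Suc_simps f)
    qed
  qed
  then have "so_stat (Suc k, map Suc rs, f')
      = card (map_prod Suc Suc ` ?A \<union> (\<lambda>s. (s, 0)) ` (S - {Min S}))"
    by (simp add: so_stat_def)
  also have "\<dots> = card (map_prod Suc Suc ` ?A) + card ((\<lambda>s. (s, 0::nat)) ` (S - {Min S}))"
    using finS finite_shifted_cells by (intro card_Un_disjoint) auto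
  also have "\<dots> = card ?A + card (S - {Min S})"
    by (simp add: card_image inj_on_def)
  finally show ?thesis
    using finS assms by (simp add: so_stat_def)
qed

lemma diag_stat_map_Suc: "diag_stat (Suc k, map Suc rs, f') = diag_stat (k, rs, f) + of_bool (0 \<in> S)"
proof -
  let ?A = "{c \<in> diagonal_cells k. f c = 1}"
  have fin: "finite (diagonal_cells k)"
    by (simp add: diagonal_cells_def)
  have "{c \<in> diagonal_cells (Suc k). f' c = 1}
      = map_prod Suc Suc ` ?A \<union> (if 0 \<in> S then {(0, 0)} else {})" (is "?L = ?R")
  proof (rule set_eqI)
    fix c :: "nat \<times> nat"
    obtain i j where c: "c = (i, j)" by (cases c)
    show "c \<in> ?L \<longleftrightarrow> c \<in> ?R"
      unfolding c by (cases i; cases j) (auto simp: diagonal_cells_def f S)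
  qed
  moreover have "card (map_prod Suc Suc ` ?A \<union> (if 0 \<in> S then {(0, 0)} else {}))
      = card (map_prod Suc Suc ` ?A) + card (if 0 \<in> S then {(0::nat, 0::nat)} else {})"
    using fin by (intro card_Un_disjoint) auto
  moreover have "card (map_prod Suc Suc ` ?A) = card ?A"
    by (simp add: card_image inj_on_def)
  ultimately show ?thesis by (simp add: diag_stat_def)
qed

end

section \<open>Decomposition of the tableaux of length n + 1\<close>

definition columns :: "nat \<times> nat list \<times> filling \<Rightarrow> nat set set" where
  "columns T = Pow (insert 0 (Suc ` free_rows T)) - {{}}"

text \<open>S refers to the rows of the enlarged diagram: old rows are shifted by one and 0 is the
  new top row. The values \<open>undefined\<close> keep the filling extensional, so that every
  tableau without empty rows in F and with a column is literally of this form.\<close>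

definition add_col :: "nat \<times> nat list \<times> filling \<Rightarrow> nat set \<Rightarrow> nat \<times> nat list \<times> filling" where
  "add_col = (\<lambda>(k, rs, f) S. (Suc k, map Suc rs,
     \<lambda>(i, j). case j of
         0 \<Rightarrow> if i \<le> k + length rs then of_bool (i \<in> S) else undefined
       | Suc j' \<Rightarrow> (case i of 0 \<Rightarrow> undefined | Suc i' \<Rightarrow> f (i', j'))))"

lemma add_colE:
  assumes "S \<in> columns (k, rs, f)"
  obtains f' where "add_col (k, rs, f) S = (Suc k, map Suc rs, f')"
    "\<And>i j. f' (Suc i, Suc j) = f (i, j)" "S = {i. i \<le> k + length rs \<and> f' (i, 0) = 1}"
    "\<forall>i\<le>k + length rs. f' (i, 0) \<in> {0, 1}" "\<forall>i>k + length rs. f' (i, 0) = undefined"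
    "\<forall>j. f' (0, Suc j) = undefined" "S \<noteq> {}" "S \<subseteq> insert 0 (Suc ` free_rows (k, rs, f))"
proof -
  have "S \<subseteq> {..k + length rs}"
    using assms by (force simp: columns_def free_rows_def Let_def)
  define f' where "f' = (\<lambda>(i, j). case j of
         0 \<Rightarrow> if i \<le> k + length rs then of_bool (i \<in> S) else undefined
       | Suc j' \<Rightarrow> (case i of 0 \<Rightarrow> undefined | Suc i' \<Rightarrow> f (i', j')))"
  show ?thesis
  proof (rule that)
    show "add_col (k, rs, f) S = (Suc k, map Suc rs, f')"
      by (simp add: add_col_def f'_def)
    show "S = {i. i \<le> k + length rs \<and> f' (i, 0) = 1}"
      using \<open>S \<subseteq> {..k + length rs}\<close> by (auto simp: f'_def)
  qed (use assms in \<open>auto simp: f'_def columns_def\<close>)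
qed

lemma add_col_in_PT_B:
  assumes "T \<in> PT_B n" "S \<in> columns T"
  shows "add_col T S \<in> PT_B (Suc n)"
proof -
  obtain k rs f where T: "T = (k, rs, f)" by (cases T)
  show ?thesis
    using assms unfolding T
    by (elim add_colE) (auto simp: PT_B_def is_tableau_B_map_Suc)
qed

lemma add_row_in_PT_B: "T \<in> PT_B n \<Longrightarrow> add_row T \<in> PT_B (Suc n)"
  by (auto simp: PT_B_def add_row_def is_tableau_B_append_0)

lemma PT_B_SucE:
  assumes "T' \<in> PT_B (Suc n)"
  obtains T where "T \<in> PT_B n" "T' = add_row T"
    | T S where "T \<in> PT_B n" "S \<in> columns T" "T' = add_col T S"
proof -
  obtain k' rs' f' where T': "T' = (k', rs', f')" by (cases T')
  have n: "length rs' + k' = Suc n" and tab: "is_tableau_B k' rs' f'"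
    using assms by (auto simp: PT_B_def T')
  have sorted: "sorted_wrt (\<ge>) rs'" and le: "\<And>r. r \<in> set rs' \<Longrightarrow> r \<le> k'"
    using tab by (auto simp: is_tableau_B_def is_ferrers_def Let_def)
  show ?thesis
  proof (cases "0 \<in> set rs'")
    case True
    then have ne: "rs' \<noteq> []" by auto
    have last: "last rs' = 0"
      using sorted True ne
      by (induction rs' rule: rev_induct) (auto simp: sorted_wrt_append)
    have rs': "rs' = butlast rs' @ [0]"
      using ne last by (metis append_butlast_last_id)
    show ?thesis
    proof (rule that(1)[of "(k', butlast rs', f')"])
      show "(k', butlast rs', f') \<in> PT_B n"
        using n tab is_tableau_B_append_0[of k' "butlast rs'" f'] rs'
        by (metis (mono_tags, lifting) PT_B_def add_Suc case_prodI length_append_singleton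
            mem_Collect_eq nat.inject)
      show "T' = add_row (k', butlast rs', f')"
        using rs' by (simp add: T' add_row_def)
    qed
  next
    case False
    \<comment> \<open>Without columns all rows of F would be empty, so there would be none, contrary
      to the positive length.\<close>
    have "k' \<noteq> 0"
    proof
      assume "k' = 0"
      then have "r = 0" if "r \<in> set rs'" for r using le[OF that] by simp
      with False have "rs' = []" by (metis list.set_intros(1) neq_Nil_conv)
      with n \<open>k' = 0\<close> show False by simp
    qed
    then obtain k where k: "k' = Suc k" by (cases k') auto
    define rs where "rs = map (\<lambda>r. r - 1) rs'"
    have rs: "rs' = map Suc rs"
      unfolding rs_def map_map using False by (intro map_idI[symmetric]) (metis Suc_pred' comp_apply gr0I)
    define f where "f = (\<lambda>(i, j). f' (Suc i, Suc j))"
    define S where "S = {i. i \<le> k + length rs \<and> f' (i, 0) = 1}"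
    have f: "f' (Suc i, Suc j) = f (i, j)" for i j by (simp add: f_def)
    have *: "is_tableau_B k rs f" "\<forall>i\<le>k + length rs. f' (i, 0) \<in> {0, 1}"
        "\<forall>i>k + length rs. f' (i, 0) = undefined" "\<forall>j. f' (0, Suc j) = undefined"
        "S \<noteq> {}" "S \<subseteq> insert 0 (Suc ` free_rows (k, rs, f))"
      using tab is_tableau_B_map_Suc[OF f S_def] by (simp_all add: k rs)
    show ?thesis
    proof (rule that(2)[of "(k, rs, f)" S])
      show "(k, rs, f) \<in> PT_B n"
        using n *(1) by (simp add: PT_B_def k rs)
      show "S \<in> columns (k, rs, f)"
        using *(5,6) by (simp add: columns_def)
      have "f' (i, j) = (case j of
           0 \<Rightarrow> if i \<le> k + length rs then of_bool (i \<in> S) else undefined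
         | Suc j' \<Rightarrow> (case i of 0 \<Rightarrow> undefined | Suc i' \<Rightarrow> f (i', j')))" for i j
      proof (cases j)
        case 0
        show ?thesis
        proof (cases "i \<le> k + length rs")
          case True
          with *(2) have "f' (i, 0) \<in> {0, 1}" by blast
          with True show ?thesis by (auto simp: 0 S_def)
        qed (use *(3) 0 in auto)
      next
        case (Suc j')
        then show ?thesis using *(4) f by (cases i) auto
      qed
      then show "T' = add_col (k, rs, f) S"
        by (auto simp: T' k rs add_col_def)
    qed
  qed
qed

lemma PT_B_Suc:
  "PT_B (Suc n) = add_row ` PT_B n \<union> (\<lambda>(T, S). add_col T S) ` (SIGMA T:PT_B n. columns T)"
proof (intro equalityI subsetI)
  fix T' assume "T' \<in> PT_B (Suc n)"
  then show "T' \<in> add_row ` PT_B n \<union> (\<lambda>(T, S). add_col T S) ` (SIGMA T:PT_B n. columns T)"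
    by (rule PT_B_SucE) force+
qed (auto simp: add_row_in_PT_B add_col_in_PT_B)

section \<open>Uniqueness of the decomposition\<close>

lemma inj_on_add_row: "inj_on add_row A"
  by (auto simp: inj_on_def add_row_def)

lemma add_col_inject:
  assumes "S1 \<in> columns T1" "S2 \<in> columns T2" "add_col T1 S1 = add_col T2 S2"
  shows "T1 = T2 \<and> S1 = S2"
proof -
  obtain k1 rs1 f1 k2 rs2 f2 where T: "T1 = (k1, rs1, f1)" "T2 = (k2, rs2, f2)"
    by (metis surj_pair)
  obtain g1 where g1: "add_col (k1, rs1, f1) S1 = (Suc k1, map Suc rs1, g1)"
      "\<And>i j. g1 (Suc i, Suc j) = f1 (i, j)" "S1 = {i. i \<le> k1 + length rs1 \<and> g1 (i, 0) = 1}"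
    using assms(1) unfolding T by (rule add_colE) (rule that; assumption)
  obtain g2 where g2: "add_col (k2, rs2, f2) S2 = (Suc k2, map Suc rs2, g2)"
      "\<And>i j. g2 (Suc i, Suc j) = f2 (i, j)" "S2 = {i. i \<le> k2 + length rs2 \<and> g2 (i, 0) = 1}"
    using assms(2) unfolding T by (rule add_colE) (rule that; assumption)
  have eq: "k1 = k2" "rs1 = rs2" "g1 = g2"
    using assms(3) g1(1) g2(1) by (auto simp: T inj_map_eq_map)
  then have "f1 = f2"
    using g1(2) g2(2) by (auto simp: fun_eq_iff)
  with eq g1(3) g2(3) show ?thesis by (simp add: T)
qed

lemma add_row_neq_add_col: "add_row T1 \<noteq> add_col T2 S"
proof
  assume "add_row T1 = add_col T2 S"
  then have "fst (snd T1) @ [0] = map Suc (fst (snd T2))"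
    by (auto simp: add_row_def add_col_def split: prod.splits)
  then have "0 \<in> set (map Suc (fst (snd T2)))"
    by (metis in_set_conv_decomp)
  then show False by simp
qed

section \<open>The generating polynomial by free rows\<close>

definition tableau_weight :: "'a::field \<Rightarrow> 'a \<Rightarrow> 'a \<Rightarrow> nat \<times> nat list \<times> filling \<Rightarrow> 'a" where
  "tableau_weight y t q T = y ^ (2 * row_stat T + diag_stat T) * t ^ diag_stat T * q ^ so_stat T"

definition free_row_poly :: "'a::field \<Rightarrow> 'a \<Rightarrow> 'a \<Rightarrow> nat \<Rightarrow> 'a poly" where
  "free_row_poly y t q n =
     (\<Sum>T\<in>PT_B n. [:tableau_weight y t q T:] * [:0, 1:] ^ card (free_rows T))"

lemma poly_free_row_poly: "poly (free_row_poly y t q n) 1 = B_poly y t q n"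
  by (simp add: free_row_poly_def poly_sum B_poly_def tableau_weight_def)

lemma free_row_poly_0: "free_row_poly y t q 0 = 1"
proof -
  have "shifted_cells 0 [] = {}" "diagonal_cells 0 = {}"
    by (auto simp: shifted_cells_def shifted_rows_def diagonal_cells_def)
  then have "PT_B 0 = {(0, [], \<lambda>_. undefined)}"
    by (auto simp: PT_B_def is_tableau_B_def is_ferrers_def Let_def)
  then show ?thesis
    by (simp add: free_row_poly_def tableau_weight_def row_stat_def diag_stat_def so_stat_def
        free_rows_def \<open>shifted_cells 0 [] = {}\<close> \<open>diagonal_cells 0 = {}\<close>)
qed

lemma tableau_weight_add_row: "tableau_weight y t q (add_row T) = y\<^sup>2 * tableau_weight y t q T"
  by (cases T) (simp add: tableau_weight_def add_row_def row_stat_def diag_stat_def so_stat_def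
      shifted_cells_append_0 power_add power2_eq_square)

lemma card_free_rows_add_row: "card (free_rows (add_row T)) = Suc (card (free_rows T))"
proof (cases T)
  case (fields k rs f)
  have "k + length rs \<notin> free_rows (k, rs, f)"
    by (simp add: free_rows_def Let_def)
  then show ?thesis
    using finite_free_rows[of T] by (simp add: fields add_row_def free_rows_add_row)
qed

text \<open>The new column has a single diagonal cell, in row 0, whose 1 contributes y t; each 1
  other than the topmost contributes q.\<close>

lemma
  assumes "S \<in> columns T"
  shows tableau_weight_add_col: "tableau_weight y t q (add_col T S)
      = tableau_weight y t q T * (y * t) ^ of_bool (0 \<in> S) * q ^ (card S - 1)"
    and card_free_rows_add_col: "card (free_rows (add_col T S))
      = card S + card {r \<in> Suc ` free_rows T. \<forall>s\<in>S. r < s}"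
proof -
  obtain k rs f where T: "T = (k, rs, f)" by (cases T)
  obtain f' where f': "add_col (k, rs, f) S = (Suc k, map Suc rs, f')"
    "\<And>i j. f' (Suc i, Suc j) = f (i, j)" "S = {i. i \<le> k + length rs \<and> f' (i, 0) = 1}"
    "\<forall>i\<le>k + length rs. f' (i, 0) \<in> {0, 1}"
    "S \<noteq> {}" "S \<subseteq> insert 0 (Suc ` free_rows (k, rs, f))"
    using assms unfolding T by (rule add_colE) (rule that; assumption)
  have "row_stat (Suc k, map Suc rs, f') = row_stat (k, rs, f)"
    by (simp add: row_stat_def)
  then show "tableau_weight y t q (add_col T S)
      = tableau_weight y t q T * (y * t) ^ of_bool (0 \<in> S) * q ^ (card S - 1)"
    unfolding T f'(1) tableau_weight_def so_stat_map_Suc[OF f'(2,3,5)]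
      diag_stat_map_Suc[OF f'(2,3)]
    by (simp add: power_add power_mult_distrib)
  have "finite S"
    by (subst f'(3)) simp
  then show "card (free_rows (add_col T S))
      = card S + card {r \<in> Suc ` free_rows T. \<forall>s\<in>S. r < s}"
    unfolding T f'(1) free_rows_map_Suc[OF f'(2,3,4,6)]
    by (intro card_Un_disjoint) (auto simp: finite_free_rows)
qed

text \<open>For a tableau with u free rows, the new empty row yields y^2 X^(u + 1). The new columns
  are summed by \<open>sum_column_weights\<close> with c = y t and the shifted free rows as A; the
  power (1 + q X)^u arising there is X^u after the substitution, so \<open>step_op\<close> appears
  term by term.\<close>

lemma free_row_poly_Suc:
  "[:-1, 1 - q:] * free_row_poly y t q (Suc n) = step_op y t q (free_row_poly y t q n)"
proof -
  define X :: "'a poly" where "X = [:0, 1:]"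
  define w where "w T = [:tableau_weight y t q T:]" for T
  define u where "u T = card (free_rows T)" for T
  define \<theta> where "\<theta> = X - 1 - [:q:] * X"
  have \<theta>: "[:-1, 1 - q:] = \<theta>" by (simp add: \<theta>_def X_def one_pCons)
  let ?Sig = "SIGMA T:PT_B n. columns T"
  let ?g = "\<lambda>T. w T * X ^ u T"
  have fin: "finite (columns T)" for T
    by (simp add: columns_def finite_free_rows)
  have "free_row_poly y t q (Suc n)
      = sum ?g (add_row ` PT_B n) + sum ?g ((\<lambda>(T, S). add_col T S) ` ?Sig)"
    unfolding free_row_poly_def PT_B_Suc w_def X_def u_def
    using finite_PT_B fin add_row_neq_add_col by (intro sum.union_disjoint) (auto, metis)
  also have "sum ?g (add_row ` PT_B n) = (\<Sum>T\<in>PT_B n. [:y\<^sup>2:] * (X * (w T * X ^ u T)))"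
    by (subst sum.reindex)
      (auto simp: inj_on_add_row u_def w_def tableau_weight_add_row card_free_rows_add_row mult.commute)
  also have "sum ?g ((\<lambda>(T, S). add_col T S) ` ?Sig)
      = (\<Sum>(T, S)\<in>?Sig. w (add_col T S) * X ^ u (add_col T S))"
    by (subst sum.reindex) (auto simp: inj_on_def case_prod_unfold dest: add_col_inject)
  also have "\<dots> = (\<Sum>T\<in>PT_B n. \<Sum>S\<in>columns T. w (add_col T S) * X ^ u (add_col T S))"
    using finite_PT_B fin by (subst sum.Sigma) auto
  also have "\<dots> = (\<Sum>T\<in>PT_B n. w T * (\<Sum>S\<in>columns T. [:y * t:] ^ of_bool (0 \<in> S) * [:q:] ^ (card S - 1)
      * X ^ (card S + card {r \<in> Suc ` free_rows T. \<forall>s\<in>S. r < s})))"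
    unfolding sum_distrib_left w_def u_def
    by (intro sum.cong refl)
      (simp add: tableau_weight_add_col card_free_rows_add_col poly_const_pow mult_ac)
  finally have "\<theta> * free_row_poly y t q (Suc n) = (\<Sum>T\<in>PT_B n. \<theta> * ([:y\<^sup>2:] * (X * (w T * X ^ u T))))
     + (\<Sum>T\<in>PT_B n. w T * (\<theta> * (\<Sum>S\<in>columns T. [:y * t:] ^ of_bool (0 \<in> S) * [:q:] ^ (card S - 1)
      * X ^ (card S + card {r \<in> Suc ` free_rows T. \<forall>s\<in>S. r < s}))))"
    by (simp only: distrib_left sum_distrib_left mult.left_commute)
  also have "\<dots> = (\<Sum>T\<in>PT_B n. \<theta> * ([:y\<^sup>2:] * (X * (w T * X ^ u T)))
      + w T * (X * (([:y * t:] * \<theta> - 1) * (1 + [:q:] * X) ^ u T + X ^ u T)))"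
    unfolding sum.distrib columns_def \<theta>_def
    by (subst sum_column_weights) (auto simp: finite_free_rows card_image u_def)
  also have "\<dots> = (\<Sum>T\<in>PT_B n. step_op y t q (w T * X ^ u T))"
  proof (intro sum.cong refl)
    fix T
    have "pcompose (X ^ m) [:1, q:] = (1 + [:q:] * X) ^ m" for m
      by (induction m) (simp_all add: pcompose_1 pcompose_mult X_def pcompose_pCons one_pCons)
    then have "pcompose (w T * X ^ u T) [:1, q:] = w T * (1 + [:q:] * X) ^ u T"
      by (simp add: w_def pcompose_smult)
    then have "step_op y t q (w T * X ^ u T) = \<theta> * ([:y\<^sup>2:] * (X * (w T * X ^ u T)))
        + X * (([:y * t:] * \<theta> - 1) * (w T * (1 + [:q:] * X) ^ u T) + w T * X ^ u T)"
      unfolding step_op_def \<theta> X_def by simp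
    then show "\<theta> * ([:y\<^sup>2:] * (X * (w T * X ^ u T)))
      + w T * (X * (([:y * t:] * \<theta> - 1) * (1 + [:q:] * X) ^ u T + X ^ u T))
      = step_op y t q (w T * X ^ u T)"
      by (simp only: distrib_left mult.left_commute)
  qed
  also have "\<dots> = step_op y t q (free_row_poly y t q n)"
    by (simp add: free_row_poly_def step_op_sum w_def X_def u_def)
  finally show ?thesis by (simp add: \<theta>)
qed

theorem theorem1p8:
  fixes y t q :: "'a::field" and \<gamma> l :: "nat \<Rightarrow> 'a"
  assumes "\<And>h. \<gamma> h = y\<^sup>2 * qint q (h + 1) + qint q h
                    + y * t * q ^ h * (qint q h + qint q (h + 1))"
    and "\<And>h. h \<ge> 1 \<Longrightarrow>
           l h = y * (qint q h)\<^sup>2 * (y + t * q ^ (h - 1)) * (1 + y * t * q ^ h)"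
  shows "has_J_fraction (Abs_fps (\<lambda>n. B_poly y t q n)) \<gamma> l"
proof -
  \<comment> \<open>Setting X = 1 forgets the free rows.\<close>
  have "B_poly y t q n = motzkin \<gamma> l n 0" for n
    unfolding poly_free_row_poly[symmetric]
    by (rule step_op_iterates[OF free_row_poly_0 free_row_poly_Suc assms])
  then show ?thesis
    using has_J_fraction_motzkin[of \<gamma> l] by simp
qed

end
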